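(* For every sublifting $K:\mathcal V\text{-}\mathsf{Cat}\to\mathcal V\text{-}\mathsf{Cat}$ of the powerset functor, $$GK(X,Y):=\bigvee_{\varphi:X\to Y\ \mathcal V\text{-module}}\tilde K\varphi(X,Y)$$ makes $\mathcal G:=\mathrm{ob}(\mathcal V\text{-}\mathsf{Cat})/\!\cong$ (the class of isomorphism classes of $\mathcal V$-categories) a (large) $\mathcal V$-category.
   Context: $\mathcal V$ is a commutative unital quantale: a complete lattice with a commutative, associative operation $\otimes$ with neutral element $k$, such that $\otimes$ preserves arbitrary suprema in each variable; it is assumed that $k>\bot$. The internal hom $\multimap$ of $\mathcal V$ is given by $z\le x\multimap y\iff z\otimes x\le y$. A $\mathcal V$-category $X=(X,a)$ is a set $X$ with $a:X\times X\to\mathcal V$ satisfying $k\le a(x,x)$ and $a(x,y)\otimes a(y,z)\le a(x,z)$; one writes $1_X^*:=a$; a large $\mathcal V$-category is the same with a class in place of a set. A $\mathcal V$-functor $f:(X,a)\to(Y,b)$ is a map with $a(x,y)\le b(f(x),f(y))$. The induced (pre)order of $X$ is $x\le y\iff k\le a(x,y)$. A $\mathcal V$-module $\varphi:X\to Y$ is a function $\varphi:X\times Y\to\mathcal V$ with $a(x',x)\otimes\varphi(x,y)\le\varphi(x',y)$ and $\varphi(x,y)\otimes b(y,y')\le\varphi(x,y')$; composition is $(\psi\cdot\varphi)(x,z)=\bigvee_{y}\varphi(x,y)\otimes\psi(y,z)$. For $f:(X,a)\to(Y,b)$: $f_*:X\to Y$, $f_*(x,y)=b(f(x),y)$, and $f^*:Y\to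 X$, $f^*(y,x)=b(y,f(x))$. $\hat X$ is the $\mathcal V$-category of functions $t:X\to\mathcal V$ with $a(x',x)\otimes t(x)\le t(x')$, with structure $1_{\hat X}^*(t,s)=\bigwedge_x t(x)\multimap s(x)$; $y_X:X\to\hat X$, $y_X(x)=a(-,x)$; for a module $\varphi:X\to Y$, $y_\varphi:Y\to\hat X$, $y_\varphi(y)=\varphi(-,y)$. For a functor $K:\mathcal V\text{-}\mathsf{Cat}\to\mathcal V\text{-}\mathsf{Cat}$ one puts $\tilde K\varphi:=(Ky_\varphi)^*\cdot(Ky_X)_*:KX\to KY$. The Hausdorff functor $H$: $HX=(PX,h_X)$ with $PX$ the powerset and $h_X(A,B)=\bigwedge_{x\in A}\bigvee_{y\in B}a(x,y)$, $Hf(A)=f(A)$. A sublifting of the powerset functor is an endofunctor $K$ of $\mathcal V\text{-}\mathsf{Cat}$ with $X\in KX\subseteq HX$ (as sets) such that the inclusion functions $\iota_X:KX\to HX$ form a lax natural transformation, i.e. they are $\mathcal V$-functors and $f(A)=(Hf)(A)\le(Kf)(A)$ in the induced order of $HY$, for all $\mathcal V$-functors $f:X\to Y$ and all $A\in KX$. In $\tilde K\varphi(X,Y)$, $X$ and $Y$ are viewed as elements of $KX$ and $KY$.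
   Formalization: For general K, GK need not be invariant under isomorphism; so the V-category axioms are shown on objects and on iso classes for any choice of representatives, and invariance only if X lies below Kf(Y) in KX for isomorphisms f:Y→X. V-categories have carriers in an arbitrary fixed set. *)

theory Defs
  imports "HOL-Library.FuncSet"
begin

section \<open>Commutative unital quantales\<close>

text \<open>The tensor is written \<open>*\<close> and its neutral element \<open>1\<close>.\<close>

class quantale = complete_lattice + comm_monoid_mult +
  assumes Sup_mult: "Sup A * y = Sup ((\<lambda>x. x * y) ` A)"
    and bot_less_one: "bot < 1"

definition residual :: "'v::quantale \<Rightarrow> 'v \<Rightarrow> 'v" (infixr \<open>\<multimap>\<close> 60)
  where "x \<multimap> y = Sup {z. z * x \<le> y}"

lemma quantale_mult_mono: "a \<le> b \<Longrightarrow> c \<le> d \<Longrightarrow> a * c \<le> b * (d::'v::quantale)"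
proof -
  have mono: "u * w \<le> v * w" if "u \<le> v" for u v w :: 'v
  proof -
    have "v * w = Sup {u, v} * w" using that by (simp add: sup.absorb2)
    also have "\<dots> = Sup ((\<lambda>x. x * w) ` {u, v})" by (rule Sup_mult)
    finally show ?thesis by (simp add: le_iff_sup)
  qed
  assume "a \<le> b" "c \<le> d"
  have "a * c \<le> b * c" using \<open>a \<le> b\<close> by (rule mono)
  also have "b * c \<le> b * d" using mono[OF \<open>c \<le> d\<close>, of b] by (simp add: mult.commute)
  finally show ?thesis .
qed

lemma residuation: "z \<le> x \<multimap> y \<longleftrightarrow> z * x \<le> (y::'v::quantale)"
proof
  assume "z \<le> x \<multimap> y"
  then have "z * x \<le> (x \<multimap> y) * x" by (rule quantale_mult_mono) simp
  also have "\<dots> = (SUP z\<in>{z. z * x \<le> y}. z * x)" unfolding residual_def by (rule Sup_mult)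
  also have "\<dots> \<le> y" by (rule SUP_least) simp
  finally show "z * x \<le> y" .
next
  assume "z * x \<le> y"
  then show "z \<le> x \<multimap> y" unfolding residual_def by (simp add: Sup_upper)
qed


section \<open>\<open>V\<close>-categories, \<open>V\<close>-functors and \<open>V\<close>-modules\<close>

text \<open>
  A \<open>V\<close>-category consists of a carrier set inside some type and a structure on it. Structures are
  normalised to \<open>bot\<close> outside the carrier, and \<open>V\<close>-functors are extensional functions, so that
  equality in HOL is equality of the set-theoretic data.
\<close>

datatype ('a, 'v) vcat = VCat (car: "'a set") (hom: "'a \<Rightarrow> 'a \<Rightarrow> 'v")

definition vcategory :: "('a, 'v::quantale) vcat \<Rightarrow> bool"
  where "vcategory X \<longleftrightarrow>
    (\<forall>x\<in>car X. 1 \<le> hom X x x) \<and>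
    (\<forall>x\<in>car X. \<forall>y\<in>car X. \<forall>z\<in>car X. hom X x y * hom X y z \<le> hom X x z) \<and>
    (\<forall>x y. \<not> (x \<in> car X \<and> y \<in> car X) \<longrightarrow> hom X x y = bot)"

definition mk_vcat :: "'a set \<Rightarrow> ('a \<Rightarrow> 'a \<Rightarrow> 'v::quantale) \<Rightarrow> ('a, 'v) vcat"
  where "mk_vcat A a = VCat A (\<lambda>x y. if x \<in> A \<and> y \<in> A then a x y else bot)"

definition vle :: "('a, 'v::quantale) vcat \<Rightarrow> 'a \<Rightarrow> 'a \<Rightarrow> bool"
  where "vle X x y \<longleftrightarrow> 1 \<le> hom X x y"

definition vfun :: "('a, 'v::quantale) vcat \<Rightarrow> ('b, 'v) vcat \<Rightarrow> ('a \<Rightarrow> 'b) set"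
  where "vfun X Y = {f \<in> car X \<rightarrow>\<^sub>E car Y. \<forall>x\<in>car X. \<forall>y\<in>car X. hom X x y \<le> hom Y (f x) (f y)}"

abbreviation vid :: "('a, 'v::quantale) vcat \<Rightarrow> 'a \<Rightarrow> 'a"
  where "vid X \<equiv> restrict (\<lambda>x. x) (car X)"

abbreviation vcomp :: "('a, 'v::quantale) vcat \<Rightarrow> ('b \<Rightarrow> 'c) \<Rightarrow> ('a \<Rightarrow> 'b) \<Rightarrow> 'a \<Rightarrow> 'c"
  where "vcomp X g f \<equiv> compose (car X) g f"

definition viso :: "('a, 'v::quantale) vcat \<Rightarrow> ('b, 'v) vcat \<Rightarrow> ('a \<Rightarrow> 'b) \<Rightarrow> bool"
  where "viso X Y f \<longleftrightarrow>
    f \<in> vfun X Y \<and> (\<exists>g\<in>vfun Y X. vcomp X g f = vid X \<and> vcomp Y f g = vid Y)"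

definition vmodule :: "('a, 'v::quantale) vcat \<Rightarrow> ('b, 'v) vcat \<Rightarrow> ('a \<Rightarrow> 'b \<Rightarrow> 'v) \<Rightarrow> bool"
  where "vmodule X Y \<phi> \<longleftrightarrow>
    (\<forall>x'\<in>car X. \<forall>x\<in>car X. \<forall>y\<in>car Y. hom X x' x * \<phi> x y \<le> \<phi> x' y) \<and>
    (\<forall>x\<in>car X. \<forall>y\<in>car Y. \<forall>y'\<in>car Y. \<phi> x y * hom Y y y' \<le> \<phi> x y')"

text \<open>The composite \<open>\<psi> \<cdot> \<phi>\<close> of modules \<open>\<phi>\<close> into and \<open>\<psi>\<close> out of \<open>Y\<close>.\<close>

definition mod_comp ::
    "('b, 'v::quantale) vcat \<Rightarrow> ('b \<Rightarrow> 'c \<Rightarrow> 'v) \<Rightarrow> ('a \<Rightarrow> 'b \<Rightarrow> 'v) \<Rightarrow> 'a \<Rightarrow> 'c \<Rightarrow> 'v"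
  where "mod_comp Y \<psi> \<phi> x z = (SUP y\<in>car Y. \<phi> x y * \<psi> y z)"

text \<open>\<open>f\<^sub>*\<close> and \<open>f\<^sup>*\<close> for a \<open>V\<close>-functor \<open>f\<close> with codomain \<open>Y\<close>.\<close>

definition lower_star :: "('b, 'v::quantale) vcat \<Rightarrow> ('a \<Rightarrow> 'b) \<Rightarrow> 'a \<Rightarrow> 'b \<Rightarrow> 'v"
  where "lower_star Y f x y = hom Y (f x) y"

definition upper_star :: "('b, 'v::quantale) vcat \<Rightarrow> ('a \<Rightarrow> 'b) \<Rightarrow> 'b \<Rightarrow> 'a \<Rightarrow> 'v"
  where "upper_star Y f y x = hom Y y (f x)"

definition hat :: "('a, 'v::quantale) vcat \<Rightarrow> ('a \<Rightarrow> 'v, 'v) vcat"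
  where "hat X = mk_vcat
    {t \<in> car X \<rightarrow>\<^sub>E UNIV. \<forall>x'\<in>car X. \<forall>x\<in>car X. hom X x' x * t x \<le> t x'}
    (\<lambda>t s. INF x\<in>car X. t x \<multimap> s x)"

definition y_mod ::
    "('a, 'v::quantale) vcat \<Rightarrow> ('b, 'v) vcat \<Rightarrow> ('a \<Rightarrow> 'b \<Rightarrow> 'v) \<Rightarrow> 'b \<Rightarrow> 'a \<Rightarrow> 'v"
  where "y_mod X Y \<phi> = (\<lambda>y\<in>car Y. \<lambda>x\<in>car X. \<phi> x y)"

definition yoneda :: "('a, 'v::quantale) vcat \<Rightarrow> 'a \<Rightarrow> 'a \<Rightarrow> 'v"
  where "yoneda X = (\<lambda>x\<in>car X. \<lambda>x'\<in>car X. hom X x' x)"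


section \<open>The Hausdorff functor and subliftings of the powerset functor\<close>

definition Hob :: "('a, 'v::quantale) vcat \<Rightarrow> ('a set, 'v) vcat"
  where "Hob X = mk_vcat (Pow (car X)) (\<lambda>A B. INF x\<in>A. SUP y\<in>B. hom X x y)"

definition Hmor :: "('a, 'v::quantale) vcat \<Rightarrow> ('a \<Rightarrow> 'b) \<Rightarrow> 'a set \<Rightarrow> 'b set"
  where "Hmor X f = (\<lambda>A\<in>Pow (car X). f ` A)"

text \<open>
  HOL has no type of all small sets, so a functor from \<open>V\<close>-Cat to \<open>V\<close>-Cat whose values have
  subsets of the argument as elements is rendered, over an arbitrary ambient type \<open>'w\<close>, by a functor
  from the category of \<open>V\<close>-categories with carrier in \<open>'w\<close> to that of \<open>V\<close>-categories with carrier
  in \<open>'w set\<close>. The action on morphisms takes domain and codomain as arguments.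
\<close>

definition vcat_endofunctor ::
    "(('w, 'v::quantale) vcat \<Rightarrow> ('w set, 'v) vcat) \<Rightarrow>
     (('w, 'v) vcat \<Rightarrow> ('w, 'v) vcat \<Rightarrow> ('w \<Rightarrow> 'w) \<Rightarrow> 'w set \<Rightarrow> 'w set) \<Rightarrow> bool"
  where "vcat_endofunctor Kob Kmor \<longleftrightarrow>
    (\<forall>X. vcategory X \<longrightarrow> vcategory (Kob X)) \<and>
    (\<forall>X Y f. vcategory X \<longrightarrow> vcategory Y \<longrightarrow> f \<in> vfun X Y \<longrightarrow> Kmor X Y f \<in> vfun (Kob X) (Kob Y)) \<and>
    (\<forall>X. vcategory X \<longrightarrow> Kmor X X (vid X) = vid (Kob X)) \<and>
    (\<forall>X Y Z f g. vcategory X \<longrightarrow> vcategory Y \<longrightarrow> vcategory Z \<longrightarrow> f \<in> vfun X Y \<longrightarrow> g \<in> vfun Y Z \<longrightarrow>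
      Kmor X Z (vcomp X g f) = vcomp (Kob X) (Kmor Y Z g) (Kmor X Y f))"

definition sublifting ::
    "(('w, 'v::quantale) vcat \<Rightarrow> ('w set, 'v) vcat) \<Rightarrow>
     (('w, 'v) vcat \<Rightarrow> ('w, 'v) vcat \<Rightarrow> ('w \<Rightarrow> 'w) \<Rightarrow> 'w set \<Rightarrow> 'w set) \<Rightarrow> bool"
  where "sublifting Kob Kmor \<longleftrightarrow>
    vcat_endofunctor Kob Kmor \<and>
    (\<forall>X. vcategory X \<longrightarrow>
      car X \<in> car (Kob X) \<and> car (Kob X) \<subseteq> car (Hob X) \<and> vid (Kob X) \<in> vfun (Kob X) (Hob X)) \<and>
    (\<forall>X Y f. vcategory X \<longrightarrow> vcategory Y \<longrightarrow> f \<in> vfun X Y \<longrightarrow>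
      (\<forall>A\<in>car (Kob X). vle (Hob Y) (Hmor X f A) (Kmor X Y f A)))"

text \<open>
  The condition that, for isomorphisms \<open>f : X \<rightarrow> Y\<close>, the image of \<open>X \<in> KX\<close> under \<open>Kf\<close> lies above
  \<open>Y \<in> KY\<close> in the order of \<open>KY\<close> (applied to the inverse of \<open>f\<close>, it also lies below). Lax naturality
  gives this only in the order of \<open>HY\<close>. It holds if \<open>KX\<close> carries the structure of \<open>HX\<close>, and also if
  \<open>Kf A = f ` A\<close> for isomorphisms \<open>f\<close>.
\<close>

definition preserves_total ::
    "(('w, 'v::quantale) vcat \<Rightarrow> ('w set, 'v) vcat) \<Rightarrow>
     (('w, 'v) vcat \<Rightarrow> ('w, 'v) vcat \<Rightarrow> ('w \<Rightarrow> 'w) \<Rightarrow> 'w set \<Rightarrow> 'w set) \<Rightarrow> bool"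
  where "preserves_total Kob Kmor \<longleftrightarrow>
    (\<forall>X Y f. vcategory X \<longrightarrow> vcategory Y \<longrightarrow> viso X Y f \<longrightarrow>
      vle (Kob Y) (car Y) (Kmor X Y f (car X)))"


section \<open>The structure \<open>GK\<close>\<close>

text \<open>
  The construction of \<open>GK\<close> applies \<open>K\<close> to \<open>V\<close>-categories \<open>X\<close> with carrier in \<open>'a\<close> and to \<open>hat X\<close>,
  with carrier in \<open>'a \<Rightarrow> 'v\<close>. Both are relabelled along the injections into the disjoint sum
  \<open>'a + ('a \<Rightarrow> 'v)\<close>, and \<open>K\<close> lives over this type.
\<close>

definition relabel :: "('a \<Rightarrow> 'w) \<Rightarrow> ('a, 'v::quantale) vcat \<Rightarrow> ('w, 'v) vcat"
  where "relabel i X = mk_vcat (i ` car X) (\<lambda>p q. hom X (inv i p) (inv i q))"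

definition relabel_fun ::
    "('a \<Rightarrow> 'w) \<Rightarrow> ('b \<Rightarrow> 'w) \<Rightarrow> ('a, 'v::quantale) vcat \<Rightarrow> ('a \<Rightarrow> 'b) \<Rightarrow> 'w \<Rightarrow> 'w"
  where "relabel_fun i j X f = (\<lambda>p \<in> i ` car X. j (f (inv i p)))"

abbreviation in_point :: "('a, 'v::quantale) vcat \<Rightarrow> ('a + ('a \<Rightarrow> 'v), 'v) vcat"
  where "in_point \<equiv> relabel Inl"

abbreviation in_presheaf :: "('a \<Rightarrow> 'v, 'v::quantale) vcat \<Rightarrow> ('a + ('a \<Rightarrow> 'v), 'v) vcat"
  where "in_presheaf \<equiv> relabel Inr"

definition Ktilde ::
    "(('a + ('a \<Rightarrow> 'v), 'v::quantale) vcat \<Rightarrow> (('a + ('a \<Rightarrow> 'v)) set, 'v) vcat) \<Rightarrow>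
     (('a + ('a \<Rightarrow> 'v), 'v) vcat \<Rightarrow> ('a + ('a \<Rightarrow> 'v), 'v) vcat \<Rightarrow>
       ('a + ('a \<Rightarrow> 'v) \<Rightarrow> 'a + ('a \<Rightarrow> 'v)) \<Rightarrow> ('a + ('a \<Rightarrow> 'v)) set \<Rightarrow> ('a + ('a \<Rightarrow> 'v)) set) \<Rightarrow>
     ('a, 'v) vcat \<Rightarrow> ('a, 'v) vcat \<Rightarrow> ('a \<Rightarrow> 'a \<Rightarrow> 'v) \<Rightarrow>
     ('a + ('a \<Rightarrow> 'v)) set \<Rightarrow> ('a + ('a \<Rightarrow> 'v)) set \<Rightarrow> 'v"
  where "Ktilde Kob Kmor X Y \<phi> =
    (let P = in_presheaf (hat X);
         Ky_X = Kmor (in_point X) P (relabel_fun Inl Inr X (yoneda X));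
         Ky_\<phi> = Kmor (in_point Y) P (relabel_fun Inl Inr Y (y_mod X Y \<phi>))
     in mod_comp (Kob P) (upper_star (Kob P) Ky_\<phi>) (lower_star (Kob P) Ky_X))"

definition GK ::
    "(('a + ('a \<Rightarrow> 'v), 'v::quantale) vcat \<Rightarrow> (('a + ('a \<Rightarrow> 'v)) set, 'v) vcat) \<Rightarrow>
     (('a + ('a \<Rightarrow> 'v), 'v) vcat \<Rightarrow> ('a + ('a \<Rightarrow> 'v), 'v) vcat \<Rightarrow>
       ('a + ('a \<Rightarrow> 'v) \<Rightarrow> 'a + ('a \<Rightarrow> 'v)) \<Rightarrow> ('a + ('a \<Rightarrow> 'v)) set \<Rightarrow> ('a + ('a \<Rightarrow> 'v)) set) \<Rightarrow>
     ('a, 'v) vcat \<Rightarrow> ('a, 'v) vcat \<Rightarrow> 'v"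
  where "GK Kob Kmor X Y =
    (SUP \<phi>\<in>{\<phi>. vmodule X Y \<phi>}. Ktilde Kob Kmor X Y \<phi> (car (in_point X)) (car (in_point Y)))"

text \<open>
  The value \<open>GK X Y\<close> can change when \<open>X\<close> and \<open>Y\<close> are replaced by isomorphic \<open>V\<close>-categories unless
  \<open>preserves_total\<close> holds; on isomorphism classes it is read off from chosen representatives.
\<close>

definition viso_rel :: "(('a, 'v::quantale) vcat \<times> ('a, 'v) vcat) set"
  where "viso_rel = {(X, Y). vcategory X \<and> vcategory Y \<and> (\<exists>f. viso X Y f)}"

definition iso_classes :: "('a, 'v::quantale) vcat set set"
  where "iso_classes = {X. vcategory X} // viso_rel"

end

theory Submission
  imports Defs
begin

text \<open>
  That \<open>GK\<close> is the structure of a \<open>V\<close>-category depends only on \<open>K\<close> being a functor and on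
  \<open>X\<close> being an element of \<open>KX\<close>. Since
  \<open>K y\<^sub>X\<close> and \<open>K y\<^sub>\<phi>\<close> have values in the \<open>V\<close>-category \<open>K(hat X)\<close>, the composite defining
  \<open>Ktilde \<phi>\<close> collapses, and \<open>Ktilde \<phi> (X, Y)\<close> is the value of the structure of \<open>K(hat X)\<close> at the
  pair \<open>K y\<^sub>X (X)\<close>, \<open>K y\<^sub>\<phi> (Y)\<close> (lemma \<open>Ktilde_total\<close>).

  Reflexivity of \<open>GK\<close> is witnessed by the identity module \<open>\<phi> = hom X\<close>, for which \<open>y\<^sub>\<phi> = y\<^sub>X\<close>.
  For transitivity, a module \<open>\<phi> : X \<rightarrow> Y\<close> induces a \<open>V\<close>-functor \<open>F : hat Y \<rightarrow> hat X\<close>,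
  \<open>t \<mapsto> t \<cdot> \<phi>\<close>, with \<open>F y\<^sub>Y = y\<^sub>\<phi>\<close> and, for every module \<open>\<psi> : Y \<rightarrow> Z\<close>, \<open>F y\<^sub>\<psi> = y\<^sub>\<chi>\<close> with
  \<open>\<chi> = \<psi> \<cdot> \<phi>\<close>. As \<open>KF\<close> is a \<open>V\<close>-functor, \<open>Ktilde \<psi> (Y, Z)\<close> is at most the distance in
  \<open>K(hat X)\<close> from \<open>K y\<^sub>\<phi> (Y)\<close> to \<open>K y\<^sub>\<chi> (Z)\<close>. The triangle inequality in \<open>K(hat X)\<close> then gives
  \<open>Ktilde \<phi> (X, Y) * Ktilde \<psi> (Y, Z) \<le> Ktilde \<chi> (X, Z)\<close>, and the tensor preserves suprema.

  For invariance under isomorphism let \<open>g : Y \<rightarrow> X\<close> be an isomorphism. The module \<open>\<phi> = g\<^sup>*\<close>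
  satisfies \<open>y\<^sub>\<phi> = y\<^sub>X g\<close>, and \<open>preserves_total\<close> says that \<open>X\<close> lies below \<open>Kg (Y)\<close> in \<open>KX\<close>;
  applying \<open>K y\<^sub>X\<close> gives \<open>1 \<le> GK X Y\<close>. Isomorphic \<open>V\<close>-categories are thus equivalent in the order
  induced by \<open>GK\<close>, and transitivity shows that \<open>GK\<close> does not distinguish them.
\<close>

section \<open>Suprema and the tensor\<close>

lemma SUP_quantale_mult: "(SUP i\<in>I. f i) * y = (SUP i\<in>I. f i * (y::'v::quantale))"
  by (simp add: Sup_mult image_image)

lemma quantale_mult_SUP: "y * (SUP i\<in>I. f i) = (SUP i\<in>I. y * (f i::'v::quantale))"
  by (simp add: mult.commute[of y] SUP_quantale_mult)

lemma residual_trans: "(x \<multimap> y) * (y \<multimap> z) \<le> x \<multimap> (z::'v::quantale)"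
proof -
  have "(x \<multimap> y) * (y \<multimap> z) * x = (x \<multimap> y) * x * (y \<multimap> z)"
    by (simp add: ac_simps)
  also have "\<dots> \<le> y * (y \<multimap> z)"
    by (rule quantale_mult_mono) (simp_all flip: residuation)
  also have "\<dots> = (y \<multimap> z) * y" by (rule mult.commute)
  also have "\<dots> \<le> z" by (simp flip: residuation)
  finally show ?thesis by (simp add: residuation)
qed


section \<open>\<open>V\<close>-categories, presheaves and modules\<close>

lemma car_mk_vcat [simp]: "car (mk_vcat A a) = A"
  by (simp add: mk_vcat_def)

lemma hom_mk_vcat [simp]: "x \<in> A \<Longrightarrow> y \<in> A \<Longrightarrow> hom (mk_vcat A a) x y = a x y"
  by (simp add: mk_vcat_def)

lemma vcategory_mk_vcatI:
  assumes "\<And>x. x \<in> A \<Longrightarrow> 1 \<le> a x x"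
    and "\<And>x y z. x \<in> A \<Longrightarrow> y \<in> A \<Longrightarrow> z \<in> A \<Longrightarrow> a x y * a y z \<le> a x z"
  shows "vcategory (mk_vcat A a)"
  using assms by (auto simp: vcategory_def mk_vcat_def)

lemma vcategory_refl: "vcategory X \<Longrightarrow> x \<in> car X \<Longrightarrow> 1 \<le> hom X x x"
  by (simp add: vcategory_def)

lemma vcategory_trans:
  "vcategory X \<Longrightarrow> x \<in> car X \<Longrightarrow> y \<in> car X \<Longrightarrow> z \<in> car X \<Longrightarrow> hom X x y * hom X y z \<le> hom X x z"
  by (simp add: vcategory_def)

lemma vfunI:
  assumes "\<And>x. x \<in> car X \<Longrightarrow> f x \<in> car Y" and "\<And>x. x \<notin> car X \<Longrightarrow> f x = undefined"
    and "\<And>x y. x \<in> car X \<Longrightarrow> y \<in> car X \<Longrightarrow> hom X x y \<le> hom Y (f x) (f y)"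
  shows "f \<in> vfun X Y"
  using assms by (auto simp: vfun_def)

lemma vfun_car: "f \<in> vfun X Y \<Longrightarrow> x \<in> car X \<Longrightarrow> f x \<in> car Y"
  by (auto simp: vfun_def)

lemma vfun_hom:
  "f \<in> vfun X Y \<Longrightarrow> x \<in> car X \<Longrightarrow> y \<in> car X \<Longrightarrow> hom X x y \<le> hom Y (f x) (f y)"
  by (simp add: vfun_def)

lemma viso_inverse:
  assumes "viso X Y f"
  obtains g where "viso Y X g"
  using assms unfolding viso_def by blast

lemma hom_times_ge:
  assumes "vcategory X" "x \<in> car X"
  shows "u \<le> u * hom X x x"
  using quantale_mult_mono[OF order_refl vcategory_refl[OF assms], of u] by simp

lemma car_hat:
  "t \<in> car (hat X) \<longleftrightarrow>
    t \<in> car X \<rightarrow>\<^sub>E UNIV \<and> (\<forall>x'\<in>car X. \<forall>x\<in>car X. hom X x' x * t x \<le> t x')"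
  by (simp add: hat_def)

lemma hom_hat:
  "t \<in> car (hat X) \<Longrightarrow> s \<in> car (hat X) \<Longrightarrow> hom (hat X) t s = (INF x\<in>car X. t x \<multimap> s x)"
  by (simp add: hat_def)

lemma hom_hat_apply:
  assumes "t \<in> car (hat X)" "s \<in> car (hat X)" "x \<in> car X"
  shows "hom (hat X) t s * t x \<le> s x"
  unfolding residuation[symmetric] hom_hat[OF assms(1,2)] using assms(3) by (rule INF_lower)

lemma vcategory_hat: "vcategory (hat X)"
  unfolding hat_def
proof (rule vcategory_mk_vcatI)
  fix t :: "'a \<Rightarrow> 'b"
  show "1 \<le> (INF x\<in>car X. t x \<multimap> t x)"
    by (simp add: le_INF_iff residuation)
next
  fix t s r :: "'a \<Rightarrow> 'b"
  show "(INF x\<in>car X. t x \<multimap> s x) * (INF x\<in>car X. s x \<multimap> r x) \<le> (INF x\<in>car X. t x \<multimap> r x)"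
  proof (rule INF_greatest)
    fix x assume "x \<in> car X"
    then have "(INF x\<in>car X. t x \<multimap> s x) * (INF x\<in>car X. s x \<multimap> r x)
        \<le> (t x \<multimap> s x) * (s x \<multimap> r x)"
      by (intro quantale_mult_mono INF_lower)
    then show "(INF x\<in>car X. t x \<multimap> s x) * (INF x\<in>car X. s x \<multimap> r x) \<le> t x \<multimap> r x"
      using residual_trans order_trans by blast
  qed
qed

lemma vmodule_left:
  "vmodule X Y \<phi> \<Longrightarrow> x' \<in> car X \<Longrightarrow> x \<in> car X \<Longrightarrow> y \<in> car Y \<Longrightarrow> hom X x' x * \<phi> x y \<le> \<phi> x' y"
  by (simp add: vmodule_def)

lemma vmodule_right:
  "vmodule X Y \<phi> \<Longrightarrow> x \<in> car X \<Longrightarrow> y \<in> car Y \<Longrightarrow> y' \<in> car Y \<Longrightarrow> \<phi> x y * hom Y y y' \<le> \<phi> x y'"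
  by (simp add: vmodule_def)

lemma vmodule_hom: "vcategory X \<Longrightarrow> vmodule X X (hom X)"
  by (simp add: vmodule_def vcategory_trans)

lemma vmodule_upper_star:
  assumes X: "vcategory X" and g: "g \<in> vfun Y X"
  shows "vmodule X Y (upper_star X g)"
  unfolding vmodule_def upper_star_def
proof (intro conjI ballI)
  fix x' x y assume "x' \<in> car X" "x \<in> car X" "y \<in> car Y"
  then show "hom X x' x * hom X x (g y) \<le> hom X x' (g y)"
    using vcategory_trans[OF X] vfun_car[OF g] by blast
next
  fix x y y' assume *: "x \<in> car X" "y \<in> car Y" "y' \<in> car Y"
  then have "hom X x (g y) * hom Y y y' \<le> hom X x (g y) * hom X (g y) (g y')"
    by (intro quantale_mult_mono order_refl vfun_hom[OF g])
  also have "\<dots> \<le> hom X x (g y')"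
    using * vcategory_trans[OF X] vfun_car[OF g] by blast
  finally show "hom X x (g y) * hom Y y y' \<le> hom X x (g y')" .
qed

lemma vmodule_mod_comp:
  assumes \<phi>: "vmodule X Y \<phi>" and \<psi>: "vmodule Y Z \<psi>"
  shows "vmodule X Z (mod_comp Y \<psi> \<phi>)"
  unfolding vmodule_def mod_comp_def quantale_mult_SUP SUP_quantale_mult
proof (intro conjI ballI)
  fix x' x z assume *: "x' \<in> car X" "x \<in> car X" "z \<in> car Z"
  show "(SUP y\<in>car Y. hom X x' x * (\<phi> x y * \<psi> y z)) \<le> (SUP y\<in>car Y. \<phi> x' y * \<psi> y z)"
  proof (rule SUP_mono)
    fix y assume "y \<in> car Y"
    then show "\<exists>y'\<in>car Y. hom X x' x * (\<phi> x y * \<psi> y z) \<le> \<phi> x' y' * \<psi> y' z"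
      using * quantale_mult_mono[OF vmodule_left[OF \<phi>] order_refl, of x' x y "\<psi> y z"]
      by (auto simp: mult.assoc)
  qed
next
  fix x z z' assume *: "x \<in> car X" "z \<in> car Z" "z' \<in> car Z"
  show "(SUP y\<in>car Y. \<phi> x y * \<psi> y z * hom Z z z') \<le> (SUP y\<in>car Y. \<phi> x y * \<psi> y z')"
  proof (rule SUP_mono)
    fix y assume "y \<in> car Y"
    then show "\<exists>y'\<in>car Y. \<phi> x y * \<psi> y z * hom Z z z' \<le> \<phi> x y' * \<psi> y' z'"
      using * quantale_mult_mono[OF order_refl vmodule_right[OF \<psi>], of y z z' "\<phi> x y"]
      by (auto simp: mult.assoc)
  qed
qed

lemma y_mod_vfun:
  assumes \<phi>: "vmodule X Y \<phi>"
  shows "y_mod X Y \<phi> \<in> vfun Y (hat X)"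
proof (rule vfunI)
  have car: "y_mod X Y \<phi> y \<in> car (hat X)" if "y \<in> car Y" for y
    using that vmodule_left[OF \<phi>] by (simp add: car_hat y_mod_def)
  then show "y_mod X Y \<phi> y \<in> car (hat X)" if "y \<in> car Y" for y
    using that .
  show "y_mod X Y \<phi> y = undefined" if "y \<notin> car Y" for y
    using that by (simp add: y_mod_def)
  show "hom Y y y' \<le> hom (hat X) (y_mod X Y \<phi> y) (y_mod X Y \<phi> y')"
    if "y \<in> car Y" "y' \<in> car Y" for y y'
    using that car vmodule_right[OF \<phi>]
    by (auto simp: hom_hat le_INF_iff residuation y_mod_def mult.commute[of "hom Y y y'"])
qed

lemma yoneda_eq_y_mod: "yoneda X = y_mod X X (hom X)"
  by (simp add: yoneda_def y_mod_def)

lemma yoneda_vfun: "vcategory X \<Longrightarrow> yoneda X \<in> vfun X (hat X)"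
  by (simp add: yoneda_eq_y_mod y_mod_vfun vmodule_hom)

lemma yoneda_comp:
  "g \<in> vfun Y X \<Longrightarrow> compose (car Y) (yoneda X) g = y_mod X Y (upper_star X g)"
  by (auto simp: compose_def yoneda_def y_mod_def upper_star_def vfun_car fun_eq_iff)

text \<open>The \<open>V\<close>-functor \<open>hat Y \<rightarrow> hat X\<close>, \<open>t \<mapsto> t \<cdot> \<phi>\<close>, induced by a module \<open>\<phi> : X \<rightarrow> Y\<close>.\<close>

definition presheaf_act ::
    "('a, 'v::quantale) vcat \<Rightarrow> ('b, 'v) vcat \<Rightarrow> ('a \<Rightarrow> 'b \<Rightarrow> 'v) \<Rightarrow> ('b \<Rightarrow> 'v) \<Rightarrow> 'a \<Rightarrow> 'v"
  where "presheaf_act X Y \<phi> = (\<lambda>t\<in>car (hat Y). \<lambda>x\<in>car X. SUP y\<in>car Y. \<phi> x y * t y)"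

lemma presheaf_act_vfun:
  assumes \<phi>: "vmodule X Y \<phi>"
  shows "presheaf_act X Y \<phi> \<in> vfun (hat Y) (hat X)"
proof (rule vfunI)
  have car: "presheaf_act X Y \<phi> t \<in> car (hat X)" if t: "t \<in> car (hat Y)" for t
    unfolding car_hat
  proof (intro conjI ballI)
    show "presheaf_act X Y \<phi> t \<in> car X \<rightarrow>\<^sub>E UNIV"
      using t by (simp add: presheaf_act_def)
    fix x' x assume *: "x' \<in> car X" "x \<in> car X"
    have "(SUP y\<in>car Y. hom X x' x * \<phi> x y * t y) \<le> (SUP y\<in>car Y. \<phi> x' y * t y)"
      using * by (intro SUP_mono) (blast intro: quantale_mult_mono vmodule_left[OF \<phi>])
    then show "hom X x' x * presheaf_act X Y \<phi> t x \<le> presheaf_act X Y \<phi> t x'"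
      using t * by (simp add: presheaf_act_def quantale_mult_SUP mult.assoc)
  qed
  then show "presheaf_act X Y \<phi> t \<in> car (hat X)" if "t \<in> car (hat Y)" for t
    using that .
  show "presheaf_act X Y \<phi> t = undefined" if "t \<notin> car (hat Y)" for t
    using that by (simp add: presheaf_act_def)
  fix t s assume ts: "t \<in> car (hat Y)" "s \<in> car (hat Y)"
  have "hom (hat Y) t s * presheaf_act X Y \<phi> t x \<le> presheaf_act X Y \<phi> s x"
    if x: "x \<in> car X" for x
  proof -
    have "\<phi> x y * (hom (hat Y) t s * t y) \<le> \<phi> x y * s y" if "y \<in> car Y" for y
      using that ts by (intro quantale_mult_mono order_refl hom_hat_apply)
    then have "(SUP y\<in>car Y. \<phi> x y * (hom (hat Y) t s * t y)) \<le> (SUP y\<in>car Y. \<phi> x y * s y)"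
      by (intro SUP_mono) blast
    then show ?thesis
      using ts x by (simp add: presheaf_act_def quantale_mult_SUP mult.left_commute)
  qed
  then show "hom (hat Y) t s \<le> hom (hat X) (presheaf_act X Y \<phi> t) (presheaf_act X Y \<phi> s)"
    using ts car by (simp add: hom_hat[of _ X] le_INF_iff residuation)
qed

lemma presheaf_act_y_mod:
  assumes "vmodule Y Z \<psi>"
  shows "compose (car Z) (presheaf_act X Y \<phi>) (y_mod Y Z \<psi>) = y_mod X Z (mod_comp Y \<psi> \<phi>)"
  using vfun_car[OF y_mod_vfun[OF assms]]
  by (auto simp: fun_eq_iff compose_def presheaf_act_def y_mod_def mod_comp_def)

text \<open>The structure of \<open>Y\<close> is the identity module of \<open>Y\<close>.\<close>

lemma mod_comp_hom:
  assumes Y: "vcategory Y" and \<phi>: "vmodule X Y \<phi>" and xy: "x \<in> car X" "y \<in> car Y"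
  shows "mod_comp Y (hom Y) \<phi> x y = \<phi> x y"
  unfolding mod_comp_def
proof (rule antisym)
  show "(SUP y'\<in>car Y. \<phi> x y' * hom Y y' y) \<le> \<phi> x y"
    using vmodule_right[OF \<phi>] xy by (intro SUP_least)
  show "\<phi> x y \<le> (SUP y'\<in>car Y. \<phi> x y' * hom Y y' y)"
    using xy hom_times_ge[OF Y] by (blast intro: SUP_upper2)
qed

lemma presheaf_act_yoneda:
  assumes "vcategory Y" "vmodule X Y \<phi>"
  shows "compose (car Y) (presheaf_act X Y \<phi>) (yoneda Y) = y_mod X Y \<phi>"
proof -
  have "compose (car Y) (presheaf_act X Y \<phi>) (yoneda Y) = y_mod X Y (mod_comp Y (hom Y) \<phi>)"
    using assms by (simp add: yoneda_eq_y_mod presheaf_act_y_mod vmodule_hom)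
  also have "\<dots> = y_mod X Y \<phi>"
    using mod_comp_hom[OF assms] by (auto simp: y_mod_def fun_eq_iff)
  finally show ?thesis .
qed


section \<open>Transport along injections\<close>

lemma car_relabel [simp]: "car (relabel i X) = i ` car X"
  by (simp add: relabel_def)

lemma hom_relabel:
  "inj i \<Longrightarrow> x \<in> car X \<Longrightarrow> y \<in> car X \<Longrightarrow> hom (relabel i X) (i x) (i y) = hom X x y"
  by (simp add: relabel_def)

lemma relabel_fun_apply: "inj i \<Longrightarrow> x \<in> car X \<Longrightarrow> relabel_fun i j X f (i x) = j (f x)"
  by (simp add: relabel_fun_def)

lemma vcategory_relabel:
  assumes "inj i" "vcategory X"
  shows "vcategory (relabel i X)"
  unfolding relabel_def using assms
  by (intro vcategory_mk_vcatI) (auto intro: vcategory_refl vcategory_trans)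

lemma relabel_fun_vfun:
  assumes "inj i" "inj j" "f \<in> vfun X Y"
  shows "relabel_fun i j X f \<in> vfun (relabel i X) (relabel j Y)"
proof (rule vfunI)
  show "relabel_fun i j X f p = undefined" if "p \<notin> car (relabel i X)" for p
    using that by (simp add: relabel_fun_def)
qed (use assms in \<open>auto simp: relabel_fun_apply hom_relabel vfun_car vfun_hom\<close>)

lemma relabel_fun_comp:
  assumes "inj i" "inj j" "f \<in> vfun X Y"
  shows "compose (i ` car X) (relabel_fun j k Y g) (relabel_fun i j X f) =
    relabel_fun i k X (compose (car X) g f)"
proof
  fix p
  show "compose (i ` car X) (relabel_fun j k Y g) (relabel_fun i j X f) p =
      relabel_fun i k X (compose (car X) g f) p"
  proof (cases "p \<in> i ` car X")
    case True
    with assms show ?thesis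
      by (auto simp: compose_def relabel_fun_apply vfun_car)
  next
    case False
    then show ?thesis by (simp add: compose_def relabel_fun_def)
  qed
qed

lemma relabel_fun_vid: "inj i \<Longrightarrow> relabel_fun i i X (vid X) = vid (relabel i X)"
  by (auto simp: relabel_fun_def fun_eq_iff)

lemma viso_relabel:
  assumes i: "inj i" and f: "viso X Y f"
  shows "viso (relabel i X) (relabel i Y) (relabel_fun i i X f)"
proof -
  obtain g where g: "g \<in> vfun Y X" "vcomp X g f = vid X" "vcomp Y f g = vid Y"
    and f': "f \<in> vfun X Y"
    using f by (auto simp: viso_def)
  show ?thesis
    unfolding viso_def
  proof (intro conjI bexI)
    show "vcomp (relabel i X) (relabel_fun i i Y g) (relabel_fun i i X f) = vid (relabel i X)"
      by (simp add: relabel_fun_comp[OF i i f'] g(2) relabel_fun_vid[OF i])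
    show "vcomp (relabel i Y) (relabel_fun i i X f) (relabel_fun i i Y g) = vid (relabel i Y)"
      by (simp add: relabel_fun_comp[OF i i g(1)] g(3) relabel_fun_vid[OF i])
  qed (use i f' g in \<open>simp_all add: relabel_fun_vfun\<close>)
qed


section \<open>The structure \<open>GK\<close>\<close>

text \<open>The composite \<open>g\<^sup>* \<cdot> f\<^sub>*\<close> through \<open>P\<close> has the values \<open>hom P (f x) (g z)\<close>: the intermediate point can be
  taken to be \<open>g z\<close>.\<close>

lemma upper_lower_star_comp:
  assumes P: "vcategory P" and u: "f x \<in> car P" and v: "g z \<in> car P"
  shows "mod_comp P (upper_star P g) (lower_star P f) x z = hom P (f x) (g z)"
  unfolding mod_comp_def upper_star_def lower_star_def
proof (rule antisym)
  show "(SUP y\<in>car P. hom P (f x) y * hom P y (g z)) \<le> hom P (f x) (g z)"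
    using vcategory_trans[OF P] u v by (blast intro: SUP_least)
  show "hom P (f x) (g z) \<le> (SUP y\<in>car P. hom P (f x) y * hom P y (g z))"
    using hom_times_ge[OF P v] v by (blast intro: SUP_upper2)
qed

text \<open>
  A functor \<open>K\<close> on \<open>V\<close>-categories over \<open>'a + ('a \<Rightarrow> 'v)\<close> with \<open>X \<in> KX\<close>: the part of the notion of a
  sublifting on which the \<open>V\<close>-category axioms for \<open>GK\<close> depend.
\<close>

locale total_functor =
  fixes Kob :: "('a + ('a \<Rightarrow> 'v), 'v::quantale) vcat \<Rightarrow> (('a + ('a \<Rightarrow> 'v)) set, 'v) vcat"
    and Kmor :: "('a + ('a \<Rightarrow> 'v), 'v) vcat \<Rightarrow> ('a + ('a \<Rightarrow> 'v), 'v) vcat \<Rightarrow>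
      ('a + ('a \<Rightarrow> 'v) \<Rightarrow> 'a + ('a \<Rightarrow> 'v)) \<Rightarrow> ('a + ('a \<Rightarrow> 'v)) set \<Rightarrow> ('a + ('a \<Rightarrow> 'v)) set"
  assumes functorial: "vcat_endofunctor Kob Kmor"
    and total: "vcategory W \<Longrightarrow> car W \<in> car (Kob W)"
begin

lemma Kob_vcategory: "vcategory W \<Longrightarrow> vcategory (Kob W)"
  using functorial by (simp add: vcat_endofunctor_def)

lemma Kmor_vfun:
  "vcategory W \<Longrightarrow> vcategory W' \<Longrightarrow> f \<in> vfun W W' \<Longrightarrow> Kmor W W' f \<in> vfun (Kob W) (Kob W')"
  using functorial by (simp add: vcat_endofunctor_def)

lemma Kmor_comp_apply:
  assumes "vcategory W" "vcategory W'" "vcategory W''" "f \<in> vfun W W'" "g \<in> vfun W' W''"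
    and "A \<in> car (Kob W)"
  shows "Kmor W W'' (vcomp W g f) A = Kmor W' W'' g (Kmor W W' f A)"
proof -
  have "Kmor W W'' (vcomp W g f) = vcomp (Kob W) (Kmor W' W'' g) (Kmor W W' f)"
    using functorial assms(1-5) unfolding vcat_endofunctor_def by blast
  then show ?thesis using assms(6) by (simp add: compose_def)
qed

text \<open>
  For \<open>f : X \<rightarrow> hat Y\<close>, the element \<open>Kf (X)\<close> of \<open>K(hat Y)\<close>, with the relabelling that the ambient
  type requires.
\<close>

definition total_image :: "('a, 'v) vcat \<Rightarrow> ('a, 'v) vcat \<Rightarrow> ('a \<Rightarrow> 'a \<Rightarrow> 'v) \<Rightarrow> ('a + ('a \<Rightarrow> 'v)) set"
  where "total_image X Y f =
    Kmor (in_point X) (in_presheaf (hat Y)) (relabel_fun Inl Inr X f) (car (in_point X))"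

text \<open>\<open>K\<close> applied to the presheaf \<open>V\<close>-category of \<open>X\<close>.\<close>

abbreviation Khat :: "('a, 'v) vcat \<Rightarrow> (('a + ('a \<Rightarrow> 'v)) set, 'v) vcat"
  where "Khat X \<equiv> Kob (in_presheaf (hat X))"

lemma vcategory_in_point: "vcategory X \<Longrightarrow> vcategory (in_point X)"
  by (simp add: vcategory_relabel)

lemma vcategory_in_presheaf_hat: "vcategory (in_presheaf (hat X))"
  by (simp add: vcategory_relabel vcategory_hat)

lemma vcategory_Khat: "vcategory (Khat X)"
  by (simp add: Kob_vcategory vcategory_in_presheaf_hat)

lemma total_image_car:
  assumes "vcategory X" "f \<in> vfun X (hat Y)"
  shows "total_image X Y f \<in> car (Khat Y)"
  unfolding total_image_def
  using assms
  by (intro vfun_car[OF Kmor_vfun] vcategory_in_point vcategory_in_presheaf_hat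
      relabel_fun_vfun total inj_Inl inj_Inr)

lemma Ktilde_total:
  assumes "vcategory X" "vcategory Y" "vmodule X Y \<phi>"
  shows "Ktilde Kob Kmor X Y \<phi> (car (in_point X)) (car (in_point Y)) =
    hom (Khat X) (total_image X X (yoneda X)) (total_image Y X (y_mod X Y \<phi>))"
  unfolding Ktilde_def Let_def total_image_def
  by (intro upper_lower_star_comp vcategory_Khat
      total_image_car[OF assms(1) yoneda_vfun[OF assms(1)], unfolded total_image_def]
      total_image_car[OF assms(2) y_mod_vfun[OF assms(3)], unfolded total_image_def])

lemma GK_eq:
  assumes "vcategory X" "vcategory Y"
  shows "GK Kob Kmor X Y = (SUP \<phi>\<in>{\<phi>. vmodule X Y \<phi>}.
    hom (Khat X) (total_image X X (yoneda X)) (total_image Y X (y_mod X Y \<phi>)))"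
  unfolding GK_def using Ktilde_total[OF assms] by (intro SUP_cong) auto

lemma GK_upper:
  assumes "vcategory X" "vcategory Y" "vmodule X Y \<phi>"
  shows "hom (Khat X) (total_image X X (yoneda X)) (total_image Y X (y_mod X Y \<phi>))
    \<le> GK Kob Kmor X Y"
  using assms by (auto simp: GK_eq intro: SUP_upper)

lemma GK_refl:
  assumes "vcategory X"
  shows "1 \<le> GK Kob Kmor X X"
  using GK_upper[OF assms assms vmodule_hom[OF assms]] assms
    vcategory_refl[OF vcategory_Khat total_image_car[OF assms yoneda_vfun[OF assms]]]
  by (auto simp: yoneda_eq_y_mod)

text \<open>Functoriality of \<open>K\<close> for a composite \<open>Z \<rightarrow> hat Y \<rightarrow> hat X\<close>, evaluated at \<open>Z \<in> KZ\<close>.\<close>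

lemma total_image_comp:
  assumes "vcategory Z" "f \<in> vfun Z (hat Y)" "F \<in> vfun (hat Y) (hat X)"
  shows "total_image Z X (compose (car Z) F f) =
    Kmor (in_presheaf (hat Y)) (in_presheaf (hat X)) (relabel_fun Inr Inr (hat Y) F)
      (total_image Z Y f)"
proof -
  have comp: "relabel_fun Inl Inr Z (compose (car Z) F f) =
      vcomp (in_point Z) (relabel_fun Inr Inr (hat Y) F) (relabel_fun Inl Inr Z f)"
    using assms(2) by (simp add: relabel_fun_comp)
  show ?thesis
    unfolding total_image_def comp using assms
    by (intro Kmor_comp_apply total vcategory_in_point vcategory_in_presheaf_hat
        relabel_fun_vfun inj_Inl inj_Inr)
qed

lemma GK_trans:
  assumes X: "vcategory X" and Y: "vcategory Y" and Z: "vcategory Z"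
  shows "GK Kob Kmor X Y * GK Kob Kmor Y Z \<le> GK Kob Kmor X Z"
proof -
  have "hom (Khat X) (total_image X X (yoneda X)) (total_image Y X (y_mod X Y \<phi>)) *
      hom (Khat Y) (total_image Y Y (yoneda Y)) (total_image Z Y (y_mod Y Z \<psi>))
      \<le> GK Kob Kmor X Z" (is "?a * ?b \<le> _")
    if \<phi>: "vmodule X Y \<phi>" and \<psi>: "vmodule Y Z \<psi>" for \<phi> \<psi>
  proof -
    let ?F = "presheaf_act X Y \<phi>" and ?\<chi> = "mod_comp Y \<psi> \<phi>"
    let ?KF = "Kmor (in_presheaf (hat Y)) (in_presheaf (hat X)) (relabel_fun Inr Inr (hat Y) ?F)"
    have F: "?F \<in> vfun (hat Y) (hat X)" using \<phi> by (rule presheaf_act_vfun)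
    have KF: "?KF \<in> vfun (Khat Y) (Khat X)"
      by (intro Kmor_vfun vcategory_in_presheaf_hat relabel_fun_vfun inj_Inr F)
    have \<chi>: "vmodule X Z ?\<chi>" using \<phi> \<psi> by (rule vmodule_mod_comp)
    have y: "yoneda Y \<in> vfun Y (hat Y)" and y\<psi>: "y_mod Y Z \<psi> \<in> vfun Z (hat Y)"
      using Y \<psi> by (simp_all add: yoneda_vfun y_mod_vfun)
    have "?b \<le> hom (Khat X) (?KF (total_image Y Y (yoneda Y)))
        (?KF (total_image Z Y (y_mod Y Z \<psi>)))"
      using KF y y\<psi> Y Z by (intro vfun_hom total_image_car)
    also have "?KF (total_image Y Y (yoneda Y)) = total_image Y X (y_mod X Y \<phi>)"
      by (simp add: presheaf_act_yoneda Y \<phi> flip: total_image_comp[OF Y y F])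
    also have "?KF (total_image Z Y (y_mod Y Z \<psi>)) = total_image Z X (y_mod X Z ?\<chi>)"
      by (simp add: presheaf_act_y_mod \<psi> flip: total_image_comp[OF Z y\<psi> F])
    finally have "?a * ?b \<le>
        ?a * hom (Khat X) (total_image Y X (y_mod X Y \<phi>)) (total_image Z X (y_mod X Z ?\<chi>))"
      by (intro quantale_mult_mono order_refl)
    also have "\<dots> \<le> hom (Khat X) (total_image X X (yoneda X)) (total_image Z X (y_mod X Z ?\<chi>))"
      using X Y Z \<phi> \<chi>
      by (intro vcategory_trans vcategory_Khat total_image_car yoneda_vfun y_mod_vfun)
    also have "\<dots> \<le> GK Kob Kmor X Z" using X Z \<chi> by (rule GK_upper)
    finally show ?thesis .
  qed
  then show ?thesis
    by (simp add: GK_eq[OF X Y] GK_eq[OF Y Z] SUP_quantale_mult quantale_mult_SUP SUP_le_iff)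
qed

text \<open>
  The relation \<open>X \<le> Kg (Y)\<close> in \<open>KX\<close> is what \<open>preserves_total\<close> asserts for an isomorphism \<open>g : Y \<rightarrow> X\<close>;
  the witnessing module is \<open>g\<^sup>*\<close>.
\<close>

lemma GK_ge_one:
  assumes X: "vcategory X" and Y: "vcategory Y" and g: "g \<in> vfun Y X"
    and le: "vle (Kob (in_point X)) (car (in_point X))
      (Kmor (in_point Y) (in_point X) (relabel_fun Inl Inl Y g) (car (in_point Y)))"
  shows "1 \<le> GK Kob Kmor X Y"
proof -
  let ?y = "relabel_fun Inl Inr X (yoneda X)" and ?g = "relabel_fun Inl Inl Y g"
  let ?KgY = "Kmor (in_point Y) (in_point X) ?g (car (in_point Y))"
  let ?Ky = "Kmor (in_point X) (in_presheaf (hat X)) ?y"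
  note cats = vcategory_in_point[OF X] vcategory_in_point[OF Y] vcategory_in_presheaf_hat[of X]
  have y: "?y \<in> vfun (in_point X) (in_presheaf (hat X))"
    by (intro relabel_fun_vfun inj_Inl inj_Inr yoneda_vfun X)
  have g': "?g \<in> vfun (in_point Y) (in_point X)"
    by (intro relabel_fun_vfun inj_Inl g)
  have KgY: "?KgY \<in> car (Kob (in_point X))"
    using cats g' by (intro vfun_car[OF Kmor_vfun] total)
  have "1 \<le> hom (Kob (in_point X)) (car (in_point X)) ?KgY"
    using le by (simp add: vle_def)
  also have "\<dots> \<le> hom (Khat X) (?Ky (car (in_point X))) (?Ky ?KgY)"
    using cats y KgY by (intro vfun_hom[OF Kmor_vfun] total)
  also have "?Ky (car (in_point X)) = total_image X X (yoneda X)"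
    by (simp add: total_image_def)
  also have "?Ky ?KgY = Kmor (in_point Y) (in_presheaf (hat X)) (vcomp (in_point Y) ?y ?g)
      (car (in_point Y))"
    using cats g' y by (intro Kmor_comp_apply[symmetric] total)
  also have "vcomp (in_point Y) ?y ?g = relabel_fun Inl Inr Y (y_mod X Y (upper_star X g))"
    using g by (simp add: relabel_fun_comp yoneda_comp)
  also have "Kmor (in_point Y) (in_presheaf (hat X)) \<dots> (car (in_point Y)) =
      total_image Y X (y_mod X Y (upper_star X g))"
    by (simp add: total_image_def)
  also have "hom (Khat X) (total_image X X (yoneda X)) \<dots> \<le> GK Kob Kmor X Y"
    using X Y vmodule_upper_star[OF X g] by (rule GK_upper)
  finally show ?thesis .
qed

lemma GK_ge_one_viso:
  assumes pt: "preserves_total Kob Kmor" and "vcategory X" "vcategory Y" and g: "viso Y X g"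
  shows "1 \<le> GK Kob Kmor X Y"
proof (rule GK_ge_one)
  show "g \<in> vfun Y X" using g by (simp add: viso_def)
  show "vle (Kob (in_point X)) (car (in_point X))
      (Kmor (in_point Y) (in_point X) (relabel_fun Inl Inl Y g) (car (in_point Y)))"
    using pt[unfolded preserves_total_def, rule_format,
        OF vcategory_in_point vcategory_in_point viso_relabel[OF inj_Inl g]] assms(2,3)
    by blast
qed fact+

lemma GK_mono_viso:
  assumes pt: "preserves_total Kob Kmor"
    and XX': "(X, X') \<in> viso_rel" and YY': "(Y, Y') \<in> viso_rel"
  shows "GK Kob Kmor X Y \<le> GK Kob Kmor X' Y'"
proof -
  obtain f g where X: "vcategory X" "vcategory X'" and f: "viso X X' f"
    and Y: "vcategory Y" "vcategory Y'" and g: "viso Y Y' g"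
    using XX' YY' by (auto simp: viso_rel_def)
  obtain g' where g': "viso Y' Y g'" using g by (rule viso_inverse)
  have "GK Kob Kmor X Y = 1 * GK Kob Kmor X Y * 1" by simp
  also have "\<dots> \<le> GK Kob Kmor X' X * GK Kob Kmor X Y * GK Kob Kmor Y Y'"
    by (intro quantale_mult_mono order_refl GK_ge_one_viso[OF pt X(2,1) f]
        GK_ge_one_viso[OF pt Y g'])
  also have "\<dots> \<le> GK Kob Kmor X' Y * GK Kob Kmor Y Y'"
    using X Y by (intro quantale_mult_mono order_refl GK_trans)
  also have "\<dots> \<le> GK Kob Kmor X' Y'"
    using X Y by (intro GK_trans)
  finally show ?thesis .
qed

end

lemma viso_rel_sym: "(X, Y) \<in> viso_rel \<Longrightarrow> (Y, X) \<in> viso_rel"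
  unfolding viso_rel_def using viso_inverse by blast

lemma iso_classes_vcategory: "C \<in> iso_classes \<Longrightarrow> X \<in> C \<Longrightarrow> vcategory X"
  by (auto simp: iso_classes_def quotient_def viso_rel_def)

theorem theorem4:
  fixes Kob :: "('a + ('a \<Rightarrow> 'v), 'v::quantale) vcat \<Rightarrow> (('a + ('a \<Rightarrow> 'v)) set, 'v) vcat"
    and Kmor :: "('a + ('a \<Rightarrow> 'v), 'v) vcat \<Rightarrow> ('a + ('a \<Rightarrow> 'v), 'v) vcat \<Rightarrow>
      ('a + ('a \<Rightarrow> 'v) \<Rightarrow> 'a + ('a \<Rightarrow> 'v)) \<Rightarrow> ('a + ('a \<Rightarrow> 'v)) set \<Rightarrow> ('a + ('a \<Rightarrow> 'v)) set"
  assumes "sublifting Kob Kmor"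
  shows "vcategory (mk_vcat {X. vcategory X} (GK Kob Kmor)) \<and>
    (\<forall>rep. (\<forall>C\<in>iso_classes. rep C \<in> C) \<longrightarrow>
      vcategory (mk_vcat iso_classes (\<lambda>C D. GK Kob Kmor (rep C) (rep D)))) \<and>
    (preserves_total Kob Kmor \<longrightarrow> congruent2 viso_rel viso_rel (GK Kob Kmor))"
proof -
  interpret total_functor Kob Kmor
    using assms by unfold_locales (simp_all add: sublifting_def)
  show ?thesis
  proof (intro conjI allI impI)
    show "vcategory (mk_vcat {X. vcategory X} (GK Kob Kmor))"
      by (rule vcategory_mk_vcatI) (simp_all add: GK_refl GK_trans)
  next
    fix rep :: "('a, 'v) vcat set \<Rightarrow> ('a, 'v) vcat"
    assume "\<forall>C\<in>iso_classes. rep C \<in> C"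
    then have "vcategory (rep C)" if "C \<in> iso_classes" for C
      using that iso_classes_vcategory by blast
    then show "vcategory (mk_vcat iso_classes (\<lambda>C D. GK Kob Kmor (rep C) (rep D)))"
      by (intro vcategory_mk_vcatI GK_refl GK_trans)
  next
    assume pt: "preserves_total Kob Kmor"
    show "congruent2 viso_rel viso_rel (GK Kob Kmor)"
      unfolding congruent2_def
    proof clarify
      fix X X' Y Y' :: "('a, 'v) vcat"
      assume XX': "(X, X') \<in> viso_rel" and YY': "(Y, Y') \<in> viso_rel"
      then show "GK Kob Kmor X Y = GK Kob Kmor X' Y'"
        by (intro antisym GK_mono_viso[OF pt XX' YY']
            GK_mono_viso[OF pt viso_rel_sym[OF XX'] viso_rel_sym[OF YY']])
    qed
  qed
qed

end
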